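(* Let $G$ be any non-orthogonal, parity-preserving linear reversible gate. Then $G$ generates $\mathrm{CNOTNOT}$, i.e. $\mathrm{CNOTNOT}\in\langle G\rangle$ (or equivalently, $\langle G\rangle$ contains all parity-preserving linear transformations).
   Context: A reversible gate (equivalently, reversible transformation) on $n\ge 1$ bits is a permutation of $\{0,1\}^n$. For a set $S$ of reversible gates (possibly on different numbers of bits), $\langle S\rangle$ is the smallest set of reversible transformations such that: (1) it contains $S$ and the identity on $\{0,1\}^n$ for all $n\ge1$; (2) if it contains $F$ and $G$ on $n$ bits, it contains $F\circ G$; (3) if it contains $F$ on $n$ bits, it contains every function obtained from $F$ by permuting its input bits and permuting its output bits; (4) if it contains $F$ on $n$ bits, it contains the $(n+1)$-bit map $(x,b)\mapsto(F(x),b)$; (5) (ancilla rule) if it contains $F$ on $n+k$ bits and there are a fixed string $a\in\{0,1\}^k$ and an $n$-bit transformation $G$ with $F(x,a)=(G(x),a)$ for all $x\in\{0,1\}^n$, then it contains $G$. $\langle G\rangle=\langle\{G\}\rangle$. A gate is linear if it has the form $G(x)=Ax$ with $A$ an invertible matrix over $\mathbb{F}_2$; parity-preserving if $|G(x)|\equiv|x|\pmod2$ for all $x$ ($|\cdot|$ is Hamming weight); orthogonal if $G(x)\cdot G(y)\equiv x\cdot y\pmod2$ for all $x,y$, where $x\cdot y=\sum_ix_iy_i$. $\mathrm{CNOTNOT}$ is the 3-bit gate $(x,y,z)\mapsto(x,y\oplus x,z\oplus x)$. *)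

theory Defs
  imports "HOL-Library.Z2" "HOL-Combinatorics.Permutations" "Jordan_Normal_Form.Matrix"
begin

text \<open>Bit strings of length \<open>n\<close> are the elements of \<open>carrier_vec n :: bit vec set\<close>. A gate carries its
  number of bits. Since \<open>f permutes A\<close> requires \<open>f\<close> to be the identity outside \<open>A\<close>, two reversible
  gates are equal as pairs exactly when they agree as maps on bit strings of the same length.\<close>

type_synonym gate = "nat \<times> (bit vec \<Rightarrow> bit vec)"

definition reversible_gate :: "gate \<Rightarrow> bool" where
  "reversible_gate = (\<lambda>(n, f). n \<ge> 1 \<and> f permutes carrier_vec n)"

definition permute_bits :: "(nat \<Rightarrow> nat) \<Rightarrow> bit vec \<Rightarrow> bit vec" where
  "permute_bits p x = vec (dim_vec x) (\<lambda>i. x $ p i)"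

text \<open>In the rules \<open>permute\<close>, \<open>extend\<close> and \<open>ancilla\<close>, the premise \<open>reversible_gate\<close> for the new
  gate, together with the equation on bit strings, determines the gate uniquely.\<close>

inductive_set generated :: "gate set \<Rightarrow> gate set" for S :: "gate set" where
  base: "g \<in> S \<Longrightarrow> g \<in> generated S"
| identity: "n \<ge> 1 \<Longrightarrow> (n, id) \<in> generated S"
| compose: "(n, F) \<in> generated S \<Longrightarrow> (n, G) \<in> generated S \<Longrightarrow> (n, F \<circ> G) \<in> generated S"
| permute: "(n, F) \<in> generated S \<Longrightarrow> p permutes {..<n} \<Longrightarrow> q permutes {..<n} \<Longrightarrow>
    reversible_gate (n, H) \<Longrightarrow>
    (\<forall>x\<in>carrier_vec n. H x = permute_bits q (F (permute_bits p x))) \<Longrightarrow>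
    (n, H) \<in> generated S"
| extend: "(n, F) \<in> generated S \<Longrightarrow> reversible_gate (n + 1, H) \<Longrightarrow>
    (\<forall>x\<in>carrier_vec n. \<forall>b\<in>carrier_vec 1. H (x @\<^sub>v b) = F x @\<^sub>v b) \<Longrightarrow>
    (n + 1, H) \<in> generated S"
| ancilla: "(n + k, F) \<in> generated S \<Longrightarrow> reversible_gate (n, G) \<Longrightarrow> a \<in> carrier_vec k \<Longrightarrow>
    (\<forall>x\<in>carrier_vec n. F (x @\<^sub>v a) = G x @\<^sub>v a) \<Longrightarrow>
    (n, G) \<in> generated S"

definition linear_gate :: "gate \<Rightarrow> bool" where
  "linear_gate = (\<lambda>(n, f). \<exists>A\<in>carrier_mat n n. invertible_mat A \<and>
     (\<forall>x\<in>carrier_vec n. f x = A *\<^sub>v x))"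

definition hamming_weight :: "bit vec \<Rightarrow> nat" where
  "hamming_weight x = card {i. i < dim_vec x \<and> x $ i = 1}"

definition parity_preserving :: "gate \<Rightarrow> bool" where
  "parity_preserving = (\<lambda>(n, f). \<forall>x\<in>carrier_vec n.
     hamming_weight (f x) mod 2 = hamming_weight x mod 2)"

text \<open>The scalar product of \<open>bit\<close> vectors is computed in the two-element field, that is, modulo 2.\<close>

definition orthogonal_gate :: "gate \<Rightarrow> bool" where
  "orthogonal_gate = (\<lambda>(n, f). \<forall>x\<in>carrier_vec n. \<forall>y\<in>carrier_vec n. f x \<bullet> f y = x \<bullet> y)"

definition CNOTNOT :: gate where
  "CNOTNOT = (3, \<lambda>v. if v \<in> carrier_vec 3
     then vec_of_list [v $ 0, v $ 1 + v $ 0, v $ 2 + v $ 0] else v)"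

lemma reversible_CNOTNOT: "reversible_gate CNOTNOT"
proof -
  define f where "f = (\<lambda>v :: bit vec. if v \<in> carrier_vec 3
     then vec_of_list [v $ 0, v $ 1 + v $ 0, v $ 2 + v $ 0] else v)"
  have "f (f v) = v" for v
  proof (cases "v \<in> carrier_vec 3")
    case True
    then have fv: "f v = vec_of_list [v $ 0, v $ 1 + v $ 0, v $ 2 + v $ 0]"
      by (simp add: f_def)
    have "f v \<in> carrier_vec 3"
      unfolding fv by (rule carrier_vecI) (simp add: dim_vec_of_list)
    then have "f (f v) = vec_of_list [f v $ 0, f v $ 1 + f v $ 0, f v $ 2 + f v $ 0]"
      by (simp add: f_def)
    also have "\<dots> = vec_of_list [v $ 0, v $ 1, v $ 2]"
      unfolding fv by (simp add: numeral_2_eq_2 add.assoc del: add_bit_eq_xor)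
    also have "\<dots> = v"
    proof (rule eq_vecI)
      fix i assume "i < dim_vec v"
      with True have "i = 0 \<or> i = 1 \<or> i = 2" by auto
      then show "vec_of_list [v $ 0, v $ 1, v $ 2] $ i = v $ i"
        by (elim disjE) (simp_all add: numeral_2_eq_2)
    qed (use True in simp)
    finally show ?thesis .
  next
    case False
    then show ?thesis by (simp add: f_def)
  qed
  then have "\<exists>!x. f x = y" for y by metis
  moreover have "f v = v" if "v \<notin> carrier_vec 3" for v
    using that by (simp add: f_def)
  ultimately have "f permutes carrier_vec 3"
    unfolding permutes_def by blast
  then have "reversible_gate (3, f)"
    by (simp add: reversible_gate_def)
  then show ?thesis
    by (simp only: CNOTNOT_def f_def)
qed

lemma generated_reversible:
  assumes "\<And>g. g \<in> S \<Longrightarrow> reversible_gate g" and "g \<in> generated S"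
  shows "reversible_gate g"
  using assms(2)
proof (induction rule: generated.induct)
  case (base g)
  then show ?case by (rule assms(1))
next
  case (identity n)
  then show ?case by (simp add: reversible_gate_def permutes_id)
next
  case (compose n F G)
  then show ?case by (auto simp: reversible_gate_def intro: permutes_compose)
qed

end

theory Submission
  imports Defs
begin

text \<open>If \<open>G(x) = A x\<close> is not orthogonal, then row \<open>i\<close> of \<open>A\<close> differs from column \<open>i\<close> of the inverse
  \<open>B\<close> for some \<open>i\<close>. Conjugating the swap of bit \<open>i\<close> with an extra bit \<open>n\<close> by \<open>A\<close> gives the
  transvection \<open>x \<mapsto> x + w (s \<cdot> x)\<close>, where \<open>s\<close> is that row, \<open>w\<close> that column, both extended by 1 at
  bit \<open>n\<close>, and \<open>s \<cdot> w = 0\<close>. Transvections with a common \<open>w\<close> (or \<open>s\<close>) compose additively in the other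
  argument. So swapping a bit \<open>j\<close> with \<open>s j \<noteq> w j\<close> against a fresh bit and multiplying the two
  transvections replaces one of \<open>w\<close>, \<open>s\<close> by a sum of two unit vectors. After doing this to \<open>w\<close>, if
  necessary after \<open>s\<close>, CNOTNOT results by setting all but three bits to 0.
  Conversely, CNOTNOTs compute any parity-preserving \<open>A x\<close> into ancillas and uncompute \<open>x\<close> from it.\<close>

text \<open>These rules would rewrite field operations on \<open>bit\<close> to bitwise ones and so
  block ring normalisation and the lemmas on sums.\<close>

declare add_bit_eq_xor [simp del] mult_bit_eq_and [simp del]

section \<open>Bits, finite sets and permutations\<close>

lemma bit_add_self [simp]: "a + a = (0 :: bit)"
  by (cases a) auto

lemma bit_add_left_self [simp]: "a + (a + b) = (b :: bit)"
  by (cases a; cases b) simp_all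

lemma of_nat_bit: "(of_nat m :: bit) = of_bool (odd m)"
  by (induction m) simp_all

lemma finite_carrier_vec_bit: "finite (carrier_vec n :: bit vec set)"
proof -
  have "UNIV = {0, 1 :: bit}"
    by (auto intro: bit.exhaust)
  then have "finite (UNIV :: bit set)"
    by (metis finite.emptyI finite.insertI)
  then have "finite {xs :: bit list. set xs \<subseteq> UNIV \<and> length xs = n}"
    by (rule finite_lists_length_eq)
  moreover have "carrier_vec n \<subseteq> vec_of_list ` {xs :: bit list. set xs \<subseteq> UNIV \<and> length xs = n}"
    by (auto intro!: image_eqI[where x = "list_of_vec _"] simp: vec_list)
  ultimately show ?thesis
    by (meson finite_imageI finite_subset)
qed

lemma permutes_if_inj_on:
  assumes "finite A" "h ` A \<subseteq> A" "inj_on h A"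
  shows "(\<lambda>x. if x \<in> A then h x else x) permutes A"
proof (rule bij_imp_permutes)
  have "bij_betw h A A"
    using assms by (simp add: bij_betw_def endo_inj_surj)
  then show "bij_betw (\<lambda>x. if x \<in> A then h x else x) A A"
    by (simp cong: bij_betw_cong)
qed auto

text \<open>A finite set has finitely many permutations, so two powers of \<open>f\<close> coincide,
  and cancelling leaves a positive power equal to the identity. \<open>generated\<close> has no rule
  for inverses; this supplies them through composition.\<close>

lemma permutes_inv_eq_funpow:
  assumes "finite A" "f permutes A"
  obtains m where "Hilbert_Choice.inv f = f ^^ m"
proof -
  have "(f ^^ m) permutes A" for m
    by (induction m) (simp_all only: funpow.simps permutes_id permutes_compose assms(2))
  then have "range (\<lambda>m. f ^^ m) \<subseteq> {g. g permutes A}"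
    by auto
  then have "finite (range (\<lambda>m. f ^^ m))"
    using finite_permutations[OF assms(1)] by (rule finite_subset)
  then have "\<not> inj (\<lambda>m. f ^^ m)"
    using finite_imageD infinite_UNIV_nat by blast
  then obtain i j where "i < j" and eq: "f ^^ i = f ^^ j"
    by (metis injI linorder_neqE_nat)
  then obtain m where j: "j = i + Suc m"
    using less_imp_Suc_add by auto
  have "bij f"
    using assms(2) by (rule permutes_bij)
  then have "inj (f ^^ i)"
    by (simp add: bij_is_inj)
  moreover have "(f ^^ i) ((f ^^ Suc m) x) = (f ^^ i) x" for x
    using fun_cong[OF eq, of x] unfolding j funpow_add comp_apply by (rule sym)
  ultimately have "f ((f ^^ m) x) = x" for x
    by (simp add: inj_eq)
  then have "Hilbert_Choice.inv f = f ^^ m"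
    using \<open>bij f\<close> by (metis bij_inv_eq_iff ext)
  then show ?thesis ..
qed

lemma sum_vec_eq_of_nat_hamming_weight:
  assumes "v \<in> carrier_vec n"
  shows "(\<Sum>i<n. v $ i) = of_nat (hamming_weight v)"
proof -
  have "(\<Sum>i<n. v $ i) = (\<Sum>i<n. of_bool (v $ i = 1))"
    by (rule sum.cong) auto
  also have "\<dots> = of_nat (hamming_weight v)"
    using assms by (simp add: hamming_weight_def Int_def)
  finally show ?thesis .
qed

text \<open>Three transpositions set the values at 0, 1 and 2 in turn; each one avoids the values
  already set.\<close>

lemma permutes_three:
  fixes i k l N :: nat
  assumes "i \<noteq> k" "i \<noteq> l" "k \<noteq> l" "i < N" "k < N" "l < N"
  obtains p where "p permutes {..<N}" "p 0 = i" "p 1 = k" "p 2 = l"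
proof
  have N: "2 < N"
    using assms by linarith
  define q where "q = transpose 0 i"
  define r where "r = transpose (q 1) k \<circ> q"
  define p where "p = transpose (r 2) l \<circ> r"
  have q: "q permutes {..<N}" and q0: "q 0 = i"
    using assms N by (auto simp: q_def intro: permutes_swap_id)
  have inj: "inj q" using q by (rule permutes_inj)
  have "q 1 \<noteq> i" using inj q0 by (metis inj_eq one_neq_zero)
  moreover have "q 1 < N" using permutes_in_image[OF q, of 1] N by simp
  ultimately have r: "r permutes {..<N}" and r0: "r 0 = i" and r1: "r 1 = k"
    using assms q q0 by (auto simp: r_def intro!: permutes_compose permutes_swap_id)
  have inj: "inj r" using r by (rule permutes_inj)
  have "r 2 \<noteq> i" "r 2 \<noteq> k" using inj_eq[OF inj, of 2 0] inj_eq[OF inj, of 2 1] r0 r1 by auto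
  moreover have "r 2 < N" using permutes_in_image[OF r, of 2] N by simp
  ultimately show "p permutes {..<N}" and "p 0 = i" "p 1 = k" "p 2 = l"
    using assms r r0 r1 unfolding p_def
    by (simp_all add: permutes_compose permutes_swap_id transpose_apply_other)
qed

section \<open>Transvections and matrices on bit sequences\<close>

text \<open>The matrix \<open>I + w s^T\<close>. It is a transvection in the usual sense when
  \<open>s\<close> and \<open>w\<close> are orthogonal; the lemmas on composition assume the
  orthogonality they use.\<close>

definition transvection :: "nat \<Rightarrow> (nat \<Rightarrow> bit) \<Rightarrow> (nat \<Rightarrow> bit) \<Rightarrow> (nat \<Rightarrow> bit) \<Rightarrow> nat \<Rightarrow> bit" where
  "transvection n w s x = (\<lambda>i. x i + w i * (\<Sum>j<n. s j * x j))"

text \<open>Fixing the coordinates from \<open>n\<close> on lets the same map describe the gate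
  after idle bits are added.\<close>

definition mat_act :: "nat \<Rightarrow> bit mat \<Rightarrow> (nat \<Rightarrow> bit) \<Rightarrow> nat \<Rightarrow> bit" where
  "mat_act n A x = (\<lambda>i. if i < n then \<Sum>j<n. A $$ (i, j) * x j else x i)"

lemma mult_mat_vec_eq_mat_act:
  "A \<in> carrier_mat n n \<Longrightarrow> A *\<^sub>v vec n x = vec n (mat_act n A x)"
  by (intro eq_vecI) (auto simp: mat_act_def scalar_prod_def lessThan_atLeast0)

lemma mat_act_inverse:
  assumes "A \<in> carrier_mat n n" "B \<in> carrier_mat n n" "A * B = 1\<^sub>m n"
  shows "mat_act n A (mat_act n B x) = x"
proof
  fix i
  have "vec n (mat_act n A (mat_act n B x)) = A *\<^sub>v (B *\<^sub>v vec n x)"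
    by (simp add: mult_mat_vec_eq_mat_act assms)
  also have "\<dots> = (A * B) *\<^sub>v vec n x"
    using assms by (intro assoc_mult_mat_vec[symmetric]) auto
  also have "\<dots> = vec n x"
    by (simp add: assms)
  finally have "vec n (mat_act n A (mat_act n B x)) $ i = vec n x $ i" by simp
  then show "mat_act n A (mat_act n B x) i = x i"
    by (cases "i < n") (simp_all add: mat_act_def)
qed

lemma linear_gateE:
  assumes "linear_gate (n, F)"
  obtains A B where "A \<in> carrier_mat n n" "B \<in> carrier_mat n n" "A * B = 1\<^sub>m n" "B * A = 1\<^sub>m n"
    "\<And>x. F (vec n x) = vec n (mat_act n A x)"
proof -
  obtain A where A: "A \<in> carrier_mat n n" "invertible_mat A" "\<forall>x\<in>carrier_vec n. F x = A *\<^sub>v x"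
    using assms by (auto simp: linear_gate_def)
  then obtain B where B: "inverts_mat A B" "inverts_mat B A"
    by (auto simp: invertible_mat_def)
  then have AB: "A * B = 1\<^sub>m n" and BA: "B * A = 1\<^sub>m (dim_row B)"
    using A(1) by (auto simp: inverts_mat_def)
  \<comment> \<open>\<open>inverts_mat\<close> does not fix the dimensions of \<open>B\<close>; they
    are read off from the two products.\<close>
  have "dim_col (A * B) = n" "dim_col (B * A) = dim_row B"
    by (simp_all only: AB BA index_one_mat)
  then have "B \<in> carrier_mat n n"
    using A(1) by auto
  then show ?thesis
    using A AB BA by (intro that) (auto simp: mult_mat_vec_eq_mat_act)
qed

section \<open>Closure properties of the generated gates\<close>

locale gate_set =
  fixes S :: "gate set"
  assumes reversible: "g \<in> S \<Longrightarrow> reversible_gate g"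
begin

text \<open>Bits beyond the first \<open>n\<close> are visible to \<open>\<phi>\<close>, but they may not influence its first \<open>n\<close> outputs.
  Working on infinite bit sequences avoids reindexing when ancillas are added.\<close>

definition realizes :: "nat \<Rightarrow> ((nat \<Rightarrow> bit) \<Rightarrow> (nat \<Rightarrow> bit)) \<Rightarrow> bool" where
  "realizes n \<phi> \<longleftrightarrow> (\<exists>F. (n, F) \<in> generated S \<and> (\<forall>x. F (vec n x) = vec n (\<phi> x)))"

lemma generated_permutes:
  assumes "(n, F) \<in> generated S"
  shows "n \<ge> 1" "F permutes carrier_vec n"
  using generated_reversible[OF reversible assms] by (auto simp: reversible_gate_def)

lemma realizesE:
  assumes "realizes n \<phi>"
  obtains F where "(n, F) \<in> generated S" "F permutes carrier_vec n" "n \<ge> 1"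
    "\<And>x. F (vec n x) = vec n (\<phi> x)"
proof -
  obtain F where F: "(n, F) \<in> generated S" "\<forall>x. F (vec n x) = vec n (\<phi> x)"
    using assms unfolding realizes_def by blast
  show ?thesis
    by (rule that[OF F(1)]) (use F(2) generated_permutes[OF F(1)] in auto)
qed

text \<open>Both \<open>H\<close> and the realizing gate permute \<open>carrier_vec n\<close>, hence
  are the identity outside it, so agreement on bit strings makes them equal as functions.\<close>

lemma realizes_imp_generated:
  assumes "realizes n \<phi>" "reversible_gate (n, H)" "\<And>x. H (vec n x) = vec n (\<phi> x)"
  shows "(n, H) \<in> generated S"
proof -
  obtain F where F: "(n, F) \<in> generated S" "F permutes carrier_vec n"
    "\<And>x. F (vec n x) = vec n (\<phi> x)"
    using assms(1) by (rule realizesE) blast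
  have "H v = F v" for v
  proof (cases "v \<in> carrier_vec n")
    case True
    then have "v = vec n (\<lambda>i. v $ i)" by auto
    then show ?thesis by (metis F(3) assms(3))
  next
    case False
    then show ?thesis
      using permutes_not_in[OF F(2)] assms(2) permutes_not_in[of H "carrier_vec n" v]
      by (simp add: reversible_gate_def)
  qed
  then show ?thesis using F(1) by (simp add: ext[of H F])
qed

lemma realizes_cong:
  assumes "realizes n \<phi>" "\<And>x i. i < n \<Longrightarrow> \<phi> x i = \<psi> x i"
  shows "realizes n \<psi>"
proof -
  have "vec n (\<phi> x) = vec n (\<psi> x)" for x
    using assms(2) by auto
  then show ?thesis using assms(1) by (simp add: realizes_def)
qed

lemma realizes_id: "n \<ge> 1 \<Longrightarrow> realizes n (\<lambda>x. x)"
  unfolding realizes_def by (intro exI[of _ id]) (simp add: generated.identity)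

lemma realizes_comp:
  assumes "realizes n \<phi>" "realizes n \<psi>"
  shows "realizes n (\<lambda>x. \<phi> (\<psi> x))"
proof -
  obtain F F' where "(n, F) \<in> generated S" "(n, F') \<in> generated S"
    "\<And>x. F (vec n x) = vec n (\<phi> x)" "\<And>x. F' (vec n x) = vec n (\<psi> x)"
    using assms unfolding realizes_def by blast
  then show ?thesis
    unfolding realizes_def by (intro exI[of _ "F \<circ> F'"]) (simp add: generated.compose)
qed

text \<open>The inverse of the gate is one of its powers. A one-sided inverse suffices because the
  gate is a bijection.\<close>

lemma realizes_inverse:
  assumes "realizes n \<phi>" "\<And>x i. i < n \<Longrightarrow> \<phi> (\<psi> x) i = x i"
  shows "realizes n \<psi>"
proof -
  obtain F where F: "(n, F) \<in> generated S" "F permutes carrier_vec n" "n \<ge> 1"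
    "\<And>x. F (vec n x) = vec n (\<phi> x)"
    using assms(1) by (rule realizesE) blast
  obtain m where m: "Hilbert_Choice.inv F = F ^^ m"
    using permutes_inv_eq_funpow[OF finite_carrier_vec_bit F(2)] .
  have "(n, F ^^ j) \<in> generated S" for j
  proof (induction j)
    case 0
    show ?case using generated.identity[OF F(3)] by (simp add: id_def)
  next
    case (Suc j)
    show ?case unfolding funpow.simps using F(1) Suc by (rule generated.compose)
  qed
  then have "(n, Hilbert_Choice.inv F) \<in> generated S" by (simp add: m)
  moreover have "Hilbert_Choice.inv F (vec n x) = vec n (\<psi> x)" for x
  proof -
    have "vec n (\<phi> (\<psi> x)) = vec n x" using assms(2) by auto
    then show ?thesis
      by (metis F(2,4) permutes_inverses(2))
  qed
  ultimately show ?thesis unfolding realizes_def by blast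
qed

lemma permute_bits_vec:
  assumes "p permutes {..<n}"
  shows "permute_bits p (vec n x) = vec n (x \<circ> p)"
  by (rule eq_vecI) (use permutes_in_image[OF assms] in \<open>simp_all add: permute_bits_def\<close>)

lemma inj_on_permute_bits:
  assumes "p permutes {..<n}"
  shows "inj_on (permute_bits p) (carrier_vec n)"
proof (rule inj_onI)
  fix v w :: "bit vec"
  assume vw: "v \<in> carrier_vec n" "w \<in> carrier_vec n" "permute_bits p v = permute_bits p w"
  show "v = w"
  proof (rule eq_vecI)
    fix i assume "i < dim_vec w"
    then have i: "i < n" using vw by simp
    then have j: "Hilbert_Choice.inv p i < n" using permutes_in_image[OF permutes_inv[OF assms], of i] by simp
    have "permute_bits p v $ Hilbert_Choice.inv p i = permute_bits p w $ Hilbert_Choice.inv p i" using vw by simp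
    then show "v $ i = w $ i"
      using vw(1,2) j by (simp add: permute_bits_def permutes_inverses[OF assms])
  qed (use vw in simp)
qed

lemma realizes_permute:
  assumes "realizes n \<phi>" "p permutes {..<n}" "q permutes {..<n}"
  shows "realizes n (\<lambda>x. \<phi> (x \<circ> p) \<circ> q)"
proof -
  obtain F where F: "(n, F) \<in> generated S" "F permutes carrier_vec n" "n \<ge> 1"
    "\<And>x. F (vec n x) = vec n (\<phi> x)"
    using assms(1) by (rule realizesE) blast
  let ?C = "carrier_vec n :: bit vec set"
  define h where "h = (\<lambda>x. permute_bits q (F (permute_bits p x)))"
  \<comment> \<open>Reversible gates have to be the identity outside \<open>carrier_vec n\<close>,
    hence the case distinction.\<close>
  define H where "H = (\<lambda>v. if v \<in> ?C then h v else v)"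
  have pC: "permute_bits r v \<in> ?C" if "v \<in> ?C" for r v
    using that by (auto simp: permute_bits_def)
  have FC: "F v \<in> ?C" if "v \<in> ?C" for v
    using that permutes_in_image[OF F(2)] by simp
  have "inj_on h ?C"
  proof (rule inj_onI)
    fix v w assume vw: "v \<in> ?C" "w \<in> ?C" "h v = h w"
    then have "F (permute_bits p v) = F (permute_bits p w)"
      unfolding h_def
      by (auto dest!: inj_onD[OF inj_on_permute_bits[OF assms(3)]] intro: FC pC)
    then have "permute_bits p v = permute_bits p w"
      by (rule injD[OF permutes_inj[OF F(2)]])
    then show "v = w"
      by (rule inj_onD[OF inj_on_permute_bits[OF assms(2)]]) (use vw in auto)
  qed
  moreover have "h ` ?C \<subseteq> ?C" unfolding h_def by (intro image_subsetI pC FC)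
  ultimately have "H permutes ?C"
    unfolding H_def by (intro permutes_if_inj_on finite_carrier_vec_bit)
  then have "reversible_gate (n, H)"
    using F(3) by (simp add: reversible_gate_def)
  then have "(n, H) \<in> generated S"
    by (rule generated.permute[OF F(1) assms(2,3)]) (simp add: H_def h_def)
  moreover have "H (vec n x) = vec n (\<phi> (x \<circ> p) \<circ> q)" for x
    by (simp only: H_def h_def permute_bits_vec[OF assms(2)] permute_bits_vec[OF assms(3)] F(4)
        vec_carrier if_True)
  ultimately show ?thesis unfolding realizes_def by blast
qed

text \<open>An idle bit leaves the map on sequences unchanged, since \<phi> already fixes every
  coordinate from \<open>n\<close> on.\<close>

lemma realizes_Suc:
  assumes "realizes n \<phi>" and ge: "\<And>x i. i \<ge> n \<Longrightarrow> \<phi> x i = x i"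
  shows "realizes (Suc n) \<phi>"
proof -
  obtain F where F: "(n, F) \<in> generated S" "F permutes carrier_vec n" "n \<ge> 1"
    "\<And>x. F (vec n x) = vec n (\<phi> x)"
    using assms(1) by (rule realizesE) blast
  let ?C = "carrier_vec (n + 1) :: bit vec set"
  define h where "h = (\<lambda>v. F (vec_first v n) @\<^sub>v vec_last v 1)"
  define H where "H = (\<lambda>v. if v \<in> ?C then h v else v)"
  have FC: "F v \<in> carrier_vec n" if "v \<in> carrier_vec n" for v
    using that permutes_in_image[OF F(2)] by simp
  have "inj_on h ?C"
  proof (rule inj_onI)
    fix v w assume vw: "v \<in> ?C" "w \<in> ?C" "h v = h w"
    have "F (vec_first v n) = F (vec_first w n)" "vec_last v 1 = vec_last w 1"
      using vw(3) append_vec_eq[OF FC FC, OF vec_first_carrier vec_first_carrier]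
      unfolding h_def by blast+
    then have "vec_first v n = vec_first w n" "vec_last v 1 = vec_last w 1"
      using permutes_inj[OF F(2)] by (auto dest: injD)
    then show "v = w" by (metis vw(1,2) vec_first_last_append)
  qed
  moreover have "h ` ?C \<subseteq> ?C"
    unfolding h_def by (intro image_subsetI append_carrier_vec FC vec_first_carrier vec_last_carrier)
  ultimately have "H permutes ?C"
    unfolding H_def by (intro permutes_if_inj_on finite_carrier_vec_bit)
  moreover have H: "H (x @\<^sub>v b) = F x @\<^sub>v b" if "x \<in> carrier_vec n" "b \<in> carrier_vec 1" for x b
  proof -
    have xb: "x @\<^sub>v b \<in> ?C" using that by (rule append_carrier_vec)
    then have "vec_first (x @\<^sub>v b) n @\<^sub>v vec_last (x @\<^sub>v b) 1 = x @\<^sub>v b"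
      by (rule vec_first_last_append)
    then have "vec_first (x @\<^sub>v b) n = x" "vec_last (x @\<^sub>v b) 1 = b"
      using append_vec_eq[OF vec_first_carrier that(1)] by auto
    then show ?thesis using xb by (simp add: H_def h_def)
  qed
  ultimately have "(n + 1, H) \<in> generated S"
    by (intro generated.extend[OF F(1)]) (auto simp: reversible_gate_def)
  moreover have "H (vec (Suc n) x) = vec (Suc n) (\<phi> x)" for x
  proof -
    have "vec (Suc n) y = vec n y @\<^sub>v vec 1 (\<lambda>_. y n)" for y :: "nat \<Rightarrow> bit"
      by (rule eq_vecI) (auto simp: less_Suc_eq)
    then show ?thesis using H by (simp add: F(4) ge)
  qed
  ultimately show ?thesis unfolding realizes_def by auto
qed

lemma realizes_extend:
  assumes "realizes n \<phi>" and "\<And>x i. i \<ge> n \<Longrightarrow> \<phi> x i = x i" and "n \<le> m"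
  shows "realizes m \<phi>"
  using assms(3)
proof (induction m rule: dec_induct)
  case base
  show ?case by (rule assms(1))
next
  case (step m)
  then show ?case using assms(2) by (intro realizes_Suc) auto
qed

text \<open>The ancilla rule for the zero string. The reduced map inherits injectivity from
  \<open>F\<close> because the ancillas return to zero.\<close>

lemma realizes_ancilla:
  assumes "realizes (n + k) \<phi>" "n \<ge> 1"
    and zero: "\<And>x i. \<lbrakk>\<And>j. n \<le> j \<Longrightarrow> x j = 0; n \<le> i; i < n + k\<rbrakk> \<Longrightarrow> \<phi> x i = 0"
  shows "realizes n (\<lambda>x. \<phi> (\<lambda>j. if j < n then x j else 0))"
proof -
  obtain F where F: "(n + k, F) \<in> generated S" "F permutes carrier_vec (n + k)"
    "\<And>x. F (vec (n + k) x) = vec (n + k) (\<phi> x)"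
    using assms(1) by (rule realizesE) blast
  let ?C = "carrier_vec n :: bit vec set"
  let ?e = "\<lambda>v :: bit vec. \<lambda>j. if j < n then v $ j else 0"
  define h where "h = (\<lambda>v. vec n (\<phi> (?e v)))"
  define H where "H = (\<lambda>v. if v \<in> ?C then h v else v)"
  have Fh: "F (v @\<^sub>v 0\<^sub>v k) = h v @\<^sub>v 0\<^sub>v k" if "v \<in> ?C" for v
  proof -
    have "v @\<^sub>v 0\<^sub>v k = vec (n + k) (?e v)"
      using that by (intro eq_vecI) auto
    moreover have "h v @\<^sub>v 0\<^sub>v k = vec (n + k) (\<phi> (?e v))"
      unfolding h_def by (rule eq_vecI) (auto simp: zero)
    ultimately show ?thesis by (simp add: F(3))
  qed
  have hC: "h ` ?C \<subseteq> ?C" by (auto simp: h_def)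
  have "inj_on h ?C"
  proof (rule inj_onI)
    fix v w assume vw: "v \<in> ?C" "w \<in> ?C" "h v = h w"
    then have "F (v @\<^sub>v 0\<^sub>v k) = F (w @\<^sub>v 0\<^sub>v k)" by (simp add: Fh)
    then have "v @\<^sub>v 0\<^sub>v k = w @\<^sub>v 0\<^sub>v k" using permutes_inj[OF F(2)] by (auto dest: injD)
    then show "v = w" using append_vec_eq[OF vw(1,2)] by blast
  qed
  then have "H permutes ?C"
    using hC unfolding H_def by (intro permutes_if_inj_on finite_carrier_vec_bit)
  then have "(n, H) \<in> generated S"
    using assms(2) by (intro generated.ancilla[OF F(1), where a = "0\<^sub>v k"])
      (auto simp: reversible_gate_def H_def Fh)
  moreover have "H (vec n x) = vec n (\<phi> (\<lambda>j. if j < n then x j else 0))" for x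
  proof -
    have "?e (vec n x) = (\<lambda>j. if j < n then x j else 0)" by auto
    then show ?thesis by (simp add: H_def h_def)
  qed
  ultimately show ?thesis unfolding realizes_def by blast
qed

section \<open>Calculus of transvections\<close>

lemma realizes_transvection_permute:
  assumes "realizes N (transvection N w s)" "p permutes {..<N}"
  shows "realizes N (transvection N (w \<circ> p) (s \<circ> p))"
proof (rule realizes_cong)
  show "realizes N (\<lambda>x. transvection N w s (x \<circ> Hilbert_Choice.inv p) \<circ> p)"
    using assms by (intro realizes_permute permutes_inv)
  fix x :: "nat \<Rightarrow> bit" and i
  have "(\<Sum>j<N. s j * x (Hilbert_Choice.inv p j)) = (\<Sum>j<N. s (p j) * x j)"
    by (subst sum.permute[OF assms(2)]) (simp add: permutes_inverses[OF assms(2)])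
  then show "(transvection N w s (x \<circ> Hilbert_Choice.inv p) \<circ> p) i
      = transvection N (w \<circ> p) (s \<circ> p) x i"
    by (simp add: transvection_def permutes_inverses[OF assms(2)])
qed

text \<open>\<open>(I + w s^T)(I + w t^T) = I + w (s + t)^T + w (s^T w) t^T\<close>, and the last
  term vanishes.\<close>

lemma realizes_transvection_add_right:
  assumes "realizes N (transvection N w s)" "realizes N (transvection N w t)"
    and "(\<Sum>j<N. s j * w j) = 0"
  shows "realizes N (transvection N w (\<lambda>j. s j + t j))"
proof (rule realizes_cong[OF realizes_comp[OF assms(1,2)]])
  fix x :: "nat \<Rightarrow> bit" and i
  define c where "c = (\<Sum>j<N. t j * x j)"
  have "(\<Sum>j<N. s j * (x j + w j * c)) = (\<Sum>j<N. s j * x j) + (\<Sum>j<N. s j * w j) * c"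
    by (simp add: sum_distrib_left sum.distrib algebra_simps)
  then show "transvection N w s (transvection N w t x) i
      = transvection N w (\<lambda>j. s j + t j) x i"
    by (simp add: transvection_def assms(3) algebra_simps sum.distrib flip: c_def)
qed

text \<open>\<open>(I + w s^T)(I + v s^T) = I + (w + v) s^T + w (s^T v) s^T\<close>, and the last
  term vanishes.\<close>

lemma realizes_transvection_add_left:
  assumes "realizes N (transvection N w s)" "realizes N (transvection N v s)"
    and "(\<Sum>j<N. s j * v j) = 0"
  shows "realizes N (transvection N (\<lambda>j. w j + v j) s)"
proof (rule realizes_cong[OF realizes_comp[OF assms(1,2)]])
  fix x :: "nat \<Rightarrow> bit" and i
  define c where "c = (\<Sum>j<N. s j * x j)"
  have "(\<Sum>j<N. s j * (x j + v j * c)) = (\<Sum>j<N. s j * x j) + (\<Sum>j<N. s j * v j) * c"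
    by (simp add: sum_distrib_left sum.distrib algebra_simps)
  then show "transvection N w s (transvection N v s x) i
      = transvection N (\<lambda>j. w j + v j) s x i"
    by (simp add: transvection_def assms(3) algebra_simps flip: c_def)
qed

text \<open>Relabel \<open>i\<close>, \<open>k\<close>, \<open>l\<close> as 0, 1, 2 and set all
  other bits to 0. They stay 0 because only bits 1 and 2 are changed, and the zero inputs hide the
  remaining entries of \<open>s\<close>, so bit 0 is the only control.\<close>

lemma CNOTNOT_if_realizes_transvection:
  assumes tv: "realizes N (transvection N (\<lambda>j. of_bool (j = k) + of_bool (j = l)) s)"
    and s: "s i = 1" "s k = 0" "s l = 0" and "k \<noteq> l" and less: "i < N" "k < N" "l < N"
  shows "CNOTNOT \<in> generated S"
proof -
  have "i \<noteq> k" "i \<noteq> l" using s by auto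
  then obtain p where p: "p permutes {..<N}" "p 0 = i" "p 1 = k" "p 2 = l"
    using permutes_three \<open>k \<noteq> l\<close> less by metis
  define w :: "nat \<Rightarrow> bit" where "w = (\<lambda>j. of_bool (j = 1) + of_bool (j = 2))"
  have "p j = k \<longleftrightarrow> j = 1" "p j = l \<longleftrightarrow> j = 2" for j
    using inj_eq[OF permutes_inj[OF p(1)], of j 1] inj_eq[OF permutes_inj[OF p(1)], of j 2] p
    by simp_all
  then have "(\<lambda>j. of_bool (j = k) + of_bool (j = l)) \<circ> p = w"
    by (auto simp: w_def)
  then have tv': "realizes N (transvection N w (s \<circ> p))"
    using realizes_transvection_permute[OF tv p(1)] by simp
  have N: "N = 3 + (N - 3)"
    using \<open>i \<noteq> k\<close> \<open>i \<noteq> l\<close> \<open>k \<noteq> l\<close> less by linarith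
  have "realizes 3 (\<lambda>x. transvection N w (s \<circ> p) (\<lambda>j. if j < 3 then x j else 0))"
    by (rule realizes_ancilla[where k = "N - 3"], subst N[symmetric], rule tv')
      (auto simp: transvection_def w_def)
  moreover have "transvection N w (s \<circ> p) (\<lambda>j. if j < 3 then x j else 0) a = x a + w a * x 0"
    if "a < 3" for x a
  proof -
    have "(\<Sum>j<N. (s \<circ> p) j * (if j < 3 then x j else 0)) = (\<Sum>j<3. (s \<circ> p) j * x j)"
      using N by (intro sum.mono_neutral_cong_right) auto
    also have "\<dots> = x 0"
      using p s by (simp add: numeral_3_eq_3 numeral_2_eq_2)
    finally show ?thesis using that by (simp add: transvection_def)
  qed
  ultimately have r: "realizes 3 (\<lambda>x a. x a + w a * x 0)"
    by (rule realizes_cong)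
  show ?thesis
    unfolding CNOTNOT_def
  proof (rule realizes_imp_generated[OF r])
    fix x :: "nat \<Rightarrow> bit"
    have "vec_of_list [x 0, x 1 + x 0, x 2 + x 0] = vec 3 (\<lambda>a. x a + w a * x 0)"
      by (rule eq_vecI) (auto simp: w_def less_Suc_eq numeral_3_eq_3 numeral_2_eq_2)
    then show "(if vec 3 x \<in> carrier_vec 3 then vec_of_list
        [vec 3 x $ 0, vec 3 x $ 1 + vec 3 x $ 0, vec 3 x $ 2 + vec 3 x $ 0] else vec 3 x)
      = vec 3 (\<lambda>a. x a + w a * x 0)"
      by simp
  qed (use reversible_CNOTNOT in \<open>simp add: CNOTNOT_def\<close>)
qed

section \<open>CNOTNOT from a non-orthogonal gate\<close>

text \<open>Over the two-element field the swap of bits \<open>i\<close> and \<open>n\<close> is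
  \<open>I + d d^T\<close> with \<open>d = e_i + e_n\<close>. Conjugation gives
  \<open>B (I + d d^T) A = I + (B d)(A^T d)^T\<close>, where \<open>A\<close> and \<open>B\<close>
  act trivially on bit \<open>n\<close>.\<close>

lemma realizes_conjugated_swap:
  assumes "realizes n (mat_act n A)"
    and AB: "A \<in> carrier_mat n n" "B \<in> carrier_mat n n" "A * B = 1\<^sub>m n" "B * A = 1\<^sub>m n"
    and "i < n" "n < N"
  shows "realizes N (transvection N (\<lambda>a. if a < n then B $$ (a, i) else of_bool (a = n))
    (\<lambda>j. if j < n then A $$ (i, j) else of_bool (j = n)))"
    (is "realizes N (transvection N ?w ?s)")
proof (rule realizes_cong)
  have "realizes n (mat_act n B)"
    by (rule realizes_inverse[OF assms(1)]) (simp add: mat_act_inverse AB)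
  then have rB: "realizes N (mat_act n B)"
    by (rule realizes_extend) (use assms in \<open>auto simp: mat_act_def\<close>)
  have rA: "realizes N (mat_act n A)"
    using assms(1) by (rule realizes_extend) (use assms in \<open>auto simp: mat_act_def\<close>)
  \<comment> \<open>The swap enters as a permutation of the output bits of \<open>A\<close>.\<close>
  show "realizes N (\<lambda>x. mat_act n B (mat_act n A (x \<circ> id) \<circ> transpose i n))"
    by (intro realizes_comp[OF rB] realizes_permute[OF rA] permutes_id permutes_swap_id)
      (use assms in auto)
  fix x :: "nat \<Rightarrow> bit" and a
  define y where "y = mat_act n A x"
  define c where "c = y i + y n"
  define d :: "nat \<Rightarrow> bit" where "d = (\<lambda>a. of_bool (a = i) + of_bool (a = n))"
  have "(\<Sum>j<N. ?s j * x j) = (\<Sum>j<Suc n. ?s j * x j)"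
    using \<open>n < N\<close> by (intro sum.mono_neutral_right) auto
  also have "\<dots> = c"
    using \<open>i < n\<close> by (simp add: c_def y_def mat_act_def)
  finally have c: "(\<Sum>j<N. ?s j * x j) = c" .
  have "y \<circ> transpose i n = (\<lambda>a. y a + d a * c)"
    using \<open>i < n\<close> by (auto simp: transpose_def d_def c_def add.commute)
  then have "mat_act n B (y \<circ> transpose i n) a = mat_act n B y a + mat_act n B d a * c"
    by (simp add: mat_act_def sum.distrib sum_distrib_left algebra_simps)
  also have "mat_act n B y = x"
    unfolding y_def by (rule mat_act_inverse) (use AB in auto)
  also have "mat_act n B d a = ?w a"
    using \<open>i < n\<close> by (auto simp: mat_act_def d_def of_bool_def if_distrib[of "(*) _"] algebra_simps sum.distrib cong: if_cong)
  finally show "mat_act n B (mat_act n A (x \<circ> id) \<circ> transpose i n) a = transvection N ?w ?s x a"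
    by (simp only: y_def comp_id transvection_def c)
qed

lemma CNOTNOT_if_not_orthogonal:
  assumes "(n, F) \<in> generated S" "linear_gate (n, F)" "\<not> orthogonal_gate (n, F)"
  shows "CNOTNOT \<in> generated S"
proof -
  obtain A B where AB: "A \<in> carrier_mat n n" "B \<in> carrier_mat n n" "A * B = 1\<^sub>m n" "B * A = 1\<^sub>m n"
    and F: "\<And>x. F (vec n x) = vec n (mat_act n A x)"
    using assms(2) by (rule linear_gateE) blast
  have rA: "realizes n (mat_act n A)"
    using assms(1) F unfolding realizes_def by blast
  \<comment> \<open>Otherwise \<open>B\<close> is the transpose of \<open>A\<close>, and moving
    \<open>A\<close> across the scalar product as \<open>B\<close> shows that \<open>F\<close> is
    orthogonal.\<close>
  have "\<exists>i<n. \<exists>j<n. A $$ (i, j) \<noteq> B $$ (j, i)"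
  proof (rule ccontr)
    assume "\<not> ?thesis"
    then have eq: "A $$ (i, j) = B $$ (j, i)" if "i < n" "j < n" for i j
      using that by blast
    have "F v \<bullet> F u = v \<bullet> u" if vu: "v \<in> carrier_vec n" "u \<in> carrier_vec n" for v u
    proof -
      define x where "x = ($) v"
      define y where "y = mat_act n A (($) u)"
      have v: "v = vec n x" and u: "u = vec n (($) u)"
        using vu by (auto simp: x_def)
      have "F v \<bullet> F u = (\<Sum>i<n. mat_act n A x i * y i)"
        by (subst u, subst v) (simp add: F scalar_prod_def lessThan_atLeast0 y_def)
      also have "\<dots> = (\<Sum>i<n. \<Sum>j<n. B $$ (j, i) * x j * y i)"
        by (intro sum.cong) (auto simp: mat_act_def sum_distrib_right eq)
      also have "\<dots> = (\<Sum>j<n. x j * mat_act n B y j)"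
        by (subst sum.swap) (auto simp: mat_act_def sum_distrib_left ac_simps intro!: sum.cong)
      also have "mat_act n B y = ($) u"
        unfolding y_def by (rule mat_act_inverse) (use AB in auto)
      also have "(\<Sum>j<n. x j * u $ j) = v \<bullet> u"
        using vu by (simp add: scalar_prod_def lessThan_atLeast0 x_def)
      finally show ?thesis .
    qed
    then show False
      using assms(3) by (auto simp: orthogonal_gate_def)
  qed
  then obtain i j where ij: "i < n" "j < n" and neq: "A $$ (i, j) \<noteq> B $$ (j, i)"
    by blast
  \<comment> \<open>Bit \<open>n\<close> is the partner of \<open>i\<close> in the conjugated swap;
    \<open>n + 1\<close> and \<open>n + 2\<close> are fresh bits for the exchanges \<open>t\<close>
    and \<open>u\<close>.\<close>
  define N where "N = n + 3"
  define w where "w = (\<lambda>a. if a < n then B $$ (a, i) else of_bool (a = n))"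
  define s where "s = (\<lambda>j. if j < n then A $$ (i, j) else of_bool (j = n))"
  define t where "t = transpose j (n + 1)"
  have r: "realizes N (transvection N w s)"
    unfolding w_def s_def N_def by (rule realizes_conjugated_swap[OF rA AB ij(1)]) simp
  \<comment> \<open>The first \<open>n\<close> terms give the diagonal entry 1 of
    \<open>A * B\<close>; bit \<open>n\<close> contributes another 1, and they cancel.\<close>
  have "(\<Sum>a<N. s a * w a) = (\<Sum>a<n. A $$ (i, a) * B $$ (a, i)) + 1"
    by (simp add: N_def s_def w_def numeral_3_eq_3)
  also have "(\<Sum>a<n. A $$ (i, a) * B $$ (a, i)) = (A * B) $$ (i, i)"
    using AB(1,2) ij by (simp add: scalar_prod_def lessThan_atLeast0)
  finally have orth: "(\<Sum>a<N. s a * w a) = 0"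
    using ij by (simp add: AB(3))
  have t: "t permutes {..<N}"
    unfolding t_def N_def using ij by (intro permutes_swap_id) auto
  note rt = realizes_transvection_permute[OF r t]
  show ?thesis
  proof (cases "s j = 1")
    case True
    then have "w j = 0" using neq ij by (simp add: s_def w_def)
    \<comment> \<open>Two rounds. \<open>t\<close> fixes \<open>w\<close> and reduces
      \<open>s\<close> to \<sigma>, the units at \<open>j\<close> and \<open>n + 1\<close>. Then
      \<open>u\<close> fixes \<sigma> and reduces \<open>w\<close> to the units at \<open>n\<close>
      and \<open>n + 2\<close>, leaving \<open>j\<close> as the control.\<close>
    define u where "u = transpose n (n + 2)"
    define \<sigma> :: "nat \<Rightarrow> bit" where "\<sigma> = (\<lambda>a. of_bool (a = j) + of_bool (a = n + 1))"
    have "w \<circ> t = w"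
      using \<open>w j = 0\<close> by (auto simp: fun_eq_iff t_def transpose_def w_def)
    moreover have "(\<lambda>a. s a + (s \<circ> t) a) = \<sigma>"
      using True ij by (auto simp: fun_eq_iff t_def transpose_def s_def \<sigma>_def)
    ultimately have r\<sigma>: "realizes N (transvection N w \<sigma>)"
      using realizes_transvection_add_right[OF r _ orth, of "s \<circ> t"] rt by simp
    have u: "u permutes {..<N}"
      unfolding u_def N_def by (intro permutes_swap_id) auto
    have "\<sigma> \<circ> u = \<sigma>"
      using ij by (auto simp: fun_eq_iff u_def transpose_def \<sigma>_def)
    then have ru: "realizes N (transvection N (w \<circ> u) \<sigma>)"
      using realizes_transvection_permute[OF r\<sigma> u] by simp
    have "(\<Sum>a<N. \<sigma> a * (w \<circ> u) a) = 0"
      using \<open>w j = 0\<close> ij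
      by (intro sum.neutral) (auto simp: \<sigma>_def u_def transpose_def w_def)
    then have "realizes N (transvection N (\<lambda>a. w a + (w \<circ> u) a) \<sigma>)"
      by (rule realizes_transvection_add_left[OF r\<sigma> ru])
    moreover have "(\<lambda>a. w a + (w \<circ> u) a) = (\<lambda>a. of_bool (a = n) + of_bool (a = n + 2))"
      by (auto simp: fun_eq_iff u_def transpose_def w_def)
    ultimately have "realizes N (transvection N (\<lambda>a. of_bool (a = n) + of_bool (a = n + 2)) \<sigma>)"
      by simp
    then show ?thesis
      by (rule CNOTNOT_if_realizes_transvection[where i = j])
        (use ij in \<open>auto simp: \<sigma>_def N_def\<close>)
  next
    case False
    then have "s j = 0" "w j = 1" using neq ij by (auto simp: s_def w_def)
    \<comment> \<open>One round suffices: \<open>w\<close> becomes the units at \<open>j\<close> and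
      \<open>n + 1\<close>, where \<open>s\<close> vanishes, and bit \<open>n\<close> with
      \<open>s n = 1\<close> is the control.\<close>
    have "s \<circ> t = s"
      using \<open>s j = 0\<close> by (auto simp: fun_eq_iff t_def transpose_def s_def)
    then have "realizes N (transvection N (\<lambda>a. (w \<circ> t) a + w a) s)"
      using realizes_transvection_add_left[OF _ r orth, of "w \<circ> t"] rt by simp
    moreover have "(\<lambda>a. (w \<circ> t) a + w a) = (\<lambda>a. of_bool (a = j) + of_bool (a = n + 1))"
      using \<open>w j = 1\<close> ij by (auto simp: fun_eq_iff t_def transpose_def w_def)
    ultimately have "realizes N (transvection N (\<lambda>a. of_bool (a = j) + of_bool (a = n + 1)) s)"
      by simp
    then show ?thesis
      by (rule CNOTNOT_if_realizes_transvection[where i = n])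
        (use ij \<open>s j = 0\<close> in \<open>auto simp: s_def N_def\<close>)
  qed
qed

section \<open>All parity-preserving linear gates from CNOTNOT\<close>

context
  assumes CNOTNOT: "CNOTNOT \<in> generated S"
begin

lemma realizes_CNOTNOT:
  assumes "i \<noteq> k" "i \<noteq> l" "k \<noteq> l" "i < m" "k < m" "l < m"
  shows "realizes m (\<lambda>x t. x t + (of_bool (t = k) + of_bool (t = l)) * x i)"
proof -
  let ?\<phi> = "\<lambda>(x :: nat \<Rightarrow> bit) t. x t + (of_bool (t = 1) + of_bool (t = 2)) * x 0"
  have "vec_of_list [x 0, x 1 + x 0, x 2 + x 0] = vec 3 (?\<phi> x)" for x
    by (rule eq_vecI) (auto simp: less_Suc_eq numeral_3_eq_3 numeral_2_eq_2)
  then have "realizes 3 ?\<phi>"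
    using CNOTNOT unfolding realizes_def CNOTNOT_def by (intro exI conjI) auto
  then have r: "realizes m ?\<phi>"
    by (rule realizes_extend) (use assms in auto)
  obtain p where p: "p permutes {..<m}" "p 0 = i" "p 1 = k" "p 2 = l"
    using permutes_three assms by metis
  have "Hilbert_Choice.inv p t = 1 \<longleftrightarrow> t = k" "Hilbert_Choice.inv p t = 2 \<longleftrightarrow> t = l" for t
    using p permutes_inv_eq[OF p(1)] by auto
  then show ?thesis
    using realizes_permute[OF r p(1) permutes_inv[OF p(1)]]
    by (simp add: comp_def p(2) permutes_inverses[OF p(1)])
qed

text \<open>No control bit is ever a target, so every control keeps its input value and the
  contributions simply add up. All the gates share the second target \<open>z\<close>.\<close>

lemma realizes_CNOTNOTs:
  assumes "finite I" "z < m" "m \<ge> 1"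
    and "\<And>q r. \<lbrakk>q \<in> I; r \<in> I\<rbrakk> \<Longrightarrow> i q \<noteq> k r"
    and "\<And>q. q \<in> I \<Longrightarrow> i q < m \<and> k q < m \<and> i q \<noteq> z \<and> k q \<noteq> z"
  shows "realizes m (\<lambda>x t. x t + (\<Sum>q\<in>I. c q * (of_bool (t = k q) + of_bool (t = z)) * x (i q)))"
  using assms(1,4,5)
proof (induction I rule: finite_induct)
  case empty
  show ?case using realizes_id[OF assms(3)] by simp
next
  case (insert q I)
  let ?f = "\<lambda>x t. \<Sum>q\<in>I. c q * (of_bool (t = k q) + of_bool (t = z)) * x (i q)"
  have IH: "realizes m (\<lambda>x t. x t + ?f x t)"
    using insert.prems by (intro insert.IH) auto
  show ?case
  proof (cases "c q = 0")
    case True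
    then show ?thesis using IH insert.hyps by simp
  next
    case False
    have zero: "?f x (i q) = 0" for x
      using insert.prems by (intro sum.neutral) (auto simp: of_bool_def)
    have "realizes m (\<lambda>x t. x t + (of_bool (t = k q) + of_bool (t = z)) * x (i q))"
      by (rule realizes_CNOTNOT) (use insert.prems(1)[of q q] insert.prems(2)[of q] assms(2) in auto)
    from realizes_comp[OF this IH] show ?thesis
      using False insert.hyps by (simp add: zero add.assoc add.left_commute) (simp add: add.commute)
  qed
qed

text \<open>For each entry 1 of \<open>A\<close> at \<open>(a, b)\<close>, use one CNOTNOT with
  control \<open>v b\<close> and targets \<open>u a\<close> and \<open>z\<close>. Thus
  \<open>z\<close> collects the sum of all output coordinates.\<close>

lemma realizes_add_mat_act:
  assumes "z < m" "\<And>a. a < n \<Longrightarrow> u a < m \<and> v a < m \<and> u a \<noteq> z \<and> v a \<noteq> z"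
    and "\<And>a b. \<lbrakk>a < n; b < n\<rbrakk> \<Longrightarrow> u a \<noteq> v b"
  shows "realizes m (\<lambda>x t. x t
    + (\<Sum>a<n. (of_bool (t = u a) + of_bool (t = z)) * mat_act n A (x \<circ> v) a))"
proof (rule realizes_cong)
  show "realizes m (\<lambda>x t. x t + (\<Sum>q\<in>{..<n} \<times> {..<n}.
      A $$ q * (of_bool (t = u (fst q)) + of_bool (t = z)) * x (v (snd q))))"
    by (rule realizes_CNOTNOTs) (use assms in \<open>fastforce+\<close>)
  show "x t + (\<Sum>q\<in>{..<n} \<times> {..<n}.
      A $$ q * (of_bool (t = u (fst q)) + of_bool (t = z)) * x (v (snd q))) =
    x t + (\<Sum>a<n. (of_bool (t = u a) + of_bool (t = z)) * mat_act n A (x \<circ> v) a)" for x t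
    by (simp add: mat_act_def sum_distrib_left sum.cartesian_product ac_simps split_def)
qed

text \<open>With \<open>n + 1\<close> ancillas, \<open>(x, 0, 0) \<mapsto> (x, A x, \<Sum>A x) \<mapsto> (x + B (A x), A x, \<Sum>A x + \<Sum>x) = (0, A x, 0)\<close>.
  The last bit makes every elementary step a CNOTNOT instead of a CNOT,
  and it is cleared because \<open>A\<close> preserves parity.\<close>

lemma linear_parity_preserving_generated:
  assumes "reversible_gate (n, H)" "linear_gate (n, H)" "parity_preserving (n, H)"
  shows "(n, H) \<in> generated S"
proof -
  obtain A B where AB: "A \<in> carrier_mat n n" "B \<in> carrier_mat n n" "A * B = 1\<^sub>m n" "B * A = 1\<^sub>m n"
    and H: "\<And>x. H (vec n x) = vec n (mat_act n A x)"
    using assms(2) by (rule linear_gateE) blast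
  have n: "n \<ge> 1" using assms(1) by (simp add: reversible_gate_def)
  have parity: "(\<Sum>a<n. mat_act n A x a) = (\<Sum>a<n. x a)" for x
  proof -
    have "hamming_weight (vec n (mat_act n A x)) mod 2 = hamming_weight (vec n x) mod 2"
      using assms(3) unfolding parity_preserving_def by (simp flip: H)
    then have "(of_nat (hamming_weight (vec n (mat_act n A x))) :: bit)
        = of_nat (hamming_weight (vec n x))"
      by (simp only: of_nat_bit odd_iff_mod_2_eq_one)
    then show ?thesis
      using sum_vec_eq_of_nat_hamming_weight[of "vec n x" n]
        sum_vec_eq_of_nat_hamming_weight[of "vec n (mat_act n A x)" n] by simp
  qed
  define m where "m = n + (n + 1)"
  define f where "f = (\<lambda>x t. x t
    + (\<Sum>a<n. (of_bool (t = n + a) + of_bool (t = 2 * n)) * mat_act n A (x \<circ> id) a))"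
  define g where "g = (\<lambda>x t. x t
    + (\<Sum>a<n. (of_bool (t = a) + of_bool (t = 2 * n)) * mat_act n B (x \<circ> (+) n) a))"
  \<comment> \<open>\<open>p\<close> exchanges the two blocks of \<open>n\<close> bits, bringing
    \<open>A x\<close> to the front.\<close>
  define p where "p = (\<lambda>a. if a < n then n + a else if a < 2 * n then a - n else a)"
  have p: "p permutes {..<m}"
  proof (rule bij_imp_permutes)
    show "bij_betw p {..<m} {..<m}"
      by (rule bij_betw_byWitness[where f' = p]) (auto simp: p_def m_def)
  qed (auto simp: p_def m_def)
  have "realizes m f"
    unfolding f_def by (rule realizes_add_mat_act) (auto simp: m_def)
  moreover have "realizes m g"
    unfolding g_def by (rule realizes_add_mat_act) (auto simp: m_def)
  ultimately have "realizes m (\<lambda>x. g (f x))"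
    by (rule realizes_comp[rotated])
  then have r: "realizes (n + (n + 1)) (\<lambda>x. g (f (x \<circ> id)) \<circ> p)"
    unfolding m_def[symmetric] using p by (intro realizes_permute permutes_id)
  have gf: "(g (f (x \<circ> id)) \<circ> p) t = (if t < n then mat_act n A x t else 0)"
    if zero: "\<And>j. n \<le> j \<Longrightarrow> x j = 0" and t: "t < m" for x t
  proof -
    let ?y = "mat_act n A x"
    \<comment> \<open>Bit \<open>2 * n\<close> receives the sum of the entries of
      \<open>A x\<close>, which \<open>parity\<close> turns into the sum of the entries of
      \<open>x\<close>.\<close>
    have f: "f x t = (if t < n then x t else if t < 2 * n then ?y (t - n) else (\<Sum>a<n. x a))"
      if "t < m" for t
    proof -
      have "t - n < n" if "\<not> t < n" "t \<noteq> 2 * n"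
        using that \<open>t < m\<close> unfolding m_def by linarith
      then consider "t < n" | b where "t = n + b" "b < n" | "t = 2 * n"
        by (metis le_add_diff_inverse not_less)
      then show ?thesis
        by cases (auto simp: f_def zero parity of_bool_def if_distrib[of "\<lambda>c. c * _"]
            intro!: sum.neutral cong: if_cong)
    qed
    have "mat_act n B (f x \<circ> (+) n) a = x a" if "a < n" for a
    proof -
      have "mat_act n B (f x \<circ> (+) n) a = mat_act n B ?y a"
        using that by (simp add: mat_act_def f m_def)
      then show ?thesis by (simp add: mat_act_inverse AB)
    qed
    \<comment> \<open>Hence \<open>g\<close> adds \<open>x\<close> to the first block and the sum of
      its entries to bit \<open>2 * n\<close>, which clears both.\<close>
    then have g: "g (f x) t = f x t + (\<Sum>a<n. (of_bool (t = a) + of_bool (t = 2 * n)) * x a)" for t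
      by (simp add: g_def)
    consider "t < n" | "n \<le> t" "t < 2 * n" | "t = 2 * n"
      using t unfolding m_def by linarith
    then show ?thesis
      by cases (auto simp: p_def g f m_def of_bool_def if_distrib[of "\<lambda>c. c * _"]
            intro!: sum.neutral cong: if_cong)
  qed
  have "realizes n (\<lambda>x. g (f ((\<lambda>j. if j < n then x j else 0) \<circ> id)) \<circ> p)"
    using r n by (rule realizes_ancilla) (subst gf; simp add: m_def)
  then have "realizes n (mat_act n A)"
  proof (rule realizes_cong)
    fix x :: "nat \<Rightarrow> bit" and i assume i: "i < n"
    have "(g (f ((\<lambda>j. if j < n then x j else 0) \<circ> id)) \<circ> p) i
        = mat_act n A (\<lambda>j. if j < n then x j else 0) i"
      using i by (subst gf) (auto simp: m_def)
    then show "(g (f ((\<lambda>j. if j < n then x j else 0) \<circ> id)) \<circ> p) i = mat_act n A x i"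
      using i by (simp add: mat_act_def)
  qed
  then show ?thesis
    using assms(1) H by (rule realizes_imp_generated)
qed

end

end

theorem theorem64:
  fixes G :: gate
  assumes "reversible_gate G" and "linear_gate G" and "parity_preserving G"
    and "\<not> orthogonal_gate G"
  shows "CNOTNOT \<in> generated {G} \<and>
    (\<forall>H. reversible_gate H \<and> linear_gate H \<and> parity_preserving H \<longrightarrow> H \<in> generated {G})"
proof -
  interpret gate_set "{G}"
    by unfold_locales (use assms(1) in simp)
  obtain n F where G: "G = (n, F)" by fastforce
  have "CNOTNOT \<in> generated {G}"
    by (rule CNOTNOT_if_not_orthogonal) (use assms in \<open>auto simp: G intro: generated.base\<close>)
  then show ?thesis
    using linear_parity_preserving_generated by auto
qed

end
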